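(* Let $g\ge 1$ be an integer, let $f : B_{2g+2}\to \operatorname{Aut}(F_{2g})$ be the group homomorphism with $f(\sigma_i)=u_i$ for $i=1,\ldots,2g+1$, where the $u_i$ are the automorphisms defined in the context, let $\pi:\operatorname{Aut}(F_{2g})\to\operatorname{GL}_{2g}(\mathbb{Z})$ be the abelianization map, and let $\overline{f}=\pi\circ f : B_{2g+2}\to\operatorname{GL}_{2g}(\mathbb{Z})$. Then $\overline{f}(B_{2g+2}) \subset \operatorname{Sp}_{2g}(\mathbb{Z})$.
   Context: $F_{2g}$ is the free group on $a_1,\ldots,a_g,b_1,\ldots,b_g$. The braid group $B_{2g+2}$ is the group with generators $\sigma_1,\ldots,\sigma_{2g+1}$ and relations, for $1\le i,j\le 2g+1$: $\sigma_i\sigma_j=\sigma_j\sigma_i$ if $|i-j|>1$, and $\sigma_i\sigma_j\sigma_i=\sigma_j\sigma_i\sigma_j$ if $|i-j|=1$. The product in $\operatorname{Aut}(F_{2g})$ is composition of automorphisms. The automorphisms $u_1,\ldots,u_{2g+1}$ of $F_{2g}$ are defined as follows. - $u_1$ fixes all generators except $b_1$, and $u_1(b_1)=a_1b_1$. - $u_{2g+1}$ fixes all generators except $b_g$, and $u_{2g+1}(b_g)=b_ga_g$. - For $i=1,\ldots,g$, $u_{2i}$ fixes all generators except $a_i$, and $u_{2i}(a_i)=b_i^{-1}a_i$. - For $i=1,\ldots,g-1$, $u_{2i+1}$ fixes all generators except $b_i$ and $b_{i+1}$, and $u_{2i+1}(b_i)=b_ia_ia_{i+1}^{-1}$, $u_{2i+1}(b_{i+1})=a_{i+1}a_i^{-1}b_{i+1}$.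 These automorphisms satisfy the defining relations of $B_{2g+2}$, so that there is a unique group homomorphism $f: B_{2g+2}\to\operatorname{Aut}(F_{2g})$ with $f(\sigma_i)=u_i$ for all $i$. The abelianization of $F_{2g}$ is identified with $\mathbb{Z}^{2g}$ with basis $(\bar a_1,\ldots,\bar a_g,\bar b_1,\ldots,\bar b_g)$, the classes of the generators, and $\operatorname{Aut}(\mathbb{Z}^{2g})$ is identified with $\operatorname{GL}_{2g}(\mathbb{Z})$ by means of this basis (the columns of a matrix are the images of the basis vectors). The map $\pi$ sends an automorphism of $F_{2g}$ to the automorphism it induces on $\mathbb{Z}^{2g}$. The symplectic modular group $\operatorname{Sp}_{2g}(\mathbb{Z})$ is the group of automorphisms of $\mathbb{Z}^{2g}$ preserving the alternating bilinear form $\langle\,,\rangle$ that vanishes on all pairs of basis elements except $\langle \bar a_i,\bar b_i\rangle=-\langle\bar b_i,\bar a_i\rangle=1$ ($i=1,\ldots,g$). Equivalently, it is the group of $M\in\operatorname{GL}_{2g}(\mathbb{Z})$ with $M^TJM=J$, where $J=\begin{pmatrix}0&I_g\\-I_g&0\end{pmatrix}$, $M^T$ is the transpose of $M$ and $I_g$ is the identity matrix of size $g$. *)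

theory Defs
  imports "HOL-Algebra.Bij" "HOL-Algebra.Generated_Groups" "Jordan_Normal_Form.Matrix"
begin

section \<open>Groups given by generators and relations\<close>

text \<open>A letter is a generator with a sign; \<open>(x, True)\<close> stands for \<open>x\<close> and \<open>(x, False)\<close> for
  its inverse. A relation is a pair of words, to be read as an equation.\<close>

type_synonym 'a word = "('a \<times> bool) list"

abbreviation (input) pos :: "'a \<Rightarrow> 'a \<times> bool" where "pos x \<equiv> (x, True)"
abbreviation (input) neg :: "'a \<Rightarrow> 'a \<times> bool" where "neg x \<equiv> (x, False)"

definition words :: "'a set \<Rightarrow> 'a word set" where
  "words S = lists (S \<times> UNIV)"

inductive_set pres_rel :: "'a set \<Rightarrow> ('a word \<times> 'a word) set \<Rightarrow> ('a word \<times> 'a word) set"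
  for S :: "'a set" and R :: "('a word \<times> 'a word) set" where
  cancel: "x \<in> S \<Longrightarrow> ([(x, s), (x, \<not> s)], []) \<in> pres_rel S R"
| relation: "(u, v) \<in> R \<Longrightarrow> u \<in> words S \<Longrightarrow> v \<in> words S \<Longrightarrow> (u, v) \<in> pres_rel S R"
| refl: "u \<in> words S \<Longrightarrow> (u, u) \<in> pres_rel S R"
| sym: "(u, v) \<in> pres_rel S R \<Longrightarrow> (v, u) \<in> pres_rel S R"
| trans: "(u, v) \<in> pres_rel S R \<Longrightarrow> (v, w) \<in> pres_rel S R \<Longrightarrow> (u, w) \<in> pres_rel S R"
| append: "(u, u') \<in> pres_rel S R \<Longrightarrow> (v, v') \<in> pres_rel S R \<Longrightarrow> (u @ v, u' @ v') \<in> pres_rel S R"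

definition word_class :: "'a set \<Rightarrow> ('a word \<times> 'a word) set \<Rightarrow> 'a word \<Rightarrow> 'a word set" where
  "word_class S R w = pres_rel S R `` {w}"

definition presented_group :: "'a set \<Rightarrow> ('a word \<times> 'a word) set \<Rightarrow> 'a word set monoid" where
  "presented_group S R =
    \<lparr>carrier = words S // pres_rel S R,
     monoid.mult = (\<lambda>U V. \<Union>u\<in>U. \<Union>v\<in>V. word_class S R (u @ v)),
     one = word_class S R []\<rparr>"

abbreviation free_group :: "'a set \<Rightarrow> 'a word set monoid" where
  "free_group S \<equiv> presented_group S {}"

definition eval_word :: "('b, 'c) monoid_scheme \<Rightarrow> ('a \<Rightarrow> 'b) \<Rightarrow> 'a word \<Rightarrow> 'b" where
  "eval_word G h w =
    foldr (\<lambda>(x, s) y. (if s then h x else inv\<^bsub>G\<^esub> h x) \<otimes>\<^bsub>G\<^esub> y) w \<one>\<^bsub>G\<^esub>"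

text \<open>The homomorphism from the free group on \<open>S\<close> to \<open>G\<close> that extends \<open>h\<close>. The value does not
  depend on the word chosen in the class, provided that \<open>G\<close> is a group and \<open>h\<close> maps \<open>S\<close>
  into its carrier.\<close>

definition free_extension ::
  "'a set \<Rightarrow> ('b, 'c) monoid_scheme \<Rightarrow> ('a \<Rightarrow> 'b) \<Rightarrow> 'a word set \<Rightarrow> 'b" where
  "free_extension S G h = (\<lambda>C\<in>carrier (free_group S). eval_word G h (SOME w. w \<in> C))"

section \<open>The braid group and its action on the free group of rank 2g\<close>

definition braid_relations :: "nat \<Rightarrow> (nat word \<times> nat word) set" where
  "braid_relations n =
    {([pos i, pos j], [pos j, pos i]) | i j.
       i \<in> {1..n - 1} \<and> j \<in> {1..n - 1} \<and> \<bar>int i - int j\<bar> > 1} \<union>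
    {([pos i, pos j, pos i], [pos j, pos i, pos j]) | i j.
       i \<in> {1..n - 1} \<and> j \<in> {1..n - 1} \<and> \<bar>int i - int j\<bar> = 1}"

text \<open>The braid group on \<open>n\<close> strands, with generators \<open>\<sigma> n 1, \<dots>, \<sigma> n (n - 1)\<close>.\<close>

definition braid_group :: "nat \<Rightarrow> nat word set monoid" where
  "braid_group n = presented_group {1..n - 1} (braid_relations n)"

definition \<sigma> :: "nat \<Rightarrow> nat \<Rightarrow> nat word set" where
  "\<sigma> n i = word_class {1..n - 1} (braid_relations n) [pos i]"

datatype gen = Gen_a nat | Gen_b nat

definition gens :: "nat \<Rightarrow> gen set" where
  "gens g = Gen_a ` {1..g} \<union> Gen_b ` {1..g}"

definition F2g :: "nat \<Rightarrow> gen word set monoid" where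
  "F2g g = free_group (gens g)"

definition F2g_class :: "nat \<Rightarrow> gen word \<Rightarrow> gen word set" where
  "F2g_class g = word_class (gens g) {}"

definition u_word :: "nat \<Rightarrow> nat \<Rightarrow> gen \<Rightarrow> gen word" where
  "u_word g i =
    (let fix_all = (\<lambda>x. [pos x]); k = i div 2 in
     if i = 1 then fix_all(Gen_b 1 := [pos (Gen_a 1), pos (Gen_b 1)])
     else if i = 2 * g + 1 then fix_all(Gen_b g := [pos (Gen_b g), pos (Gen_a g)])
     else if even i then fix_all(Gen_a k := [neg (Gen_b k), pos (Gen_a k)])
     else fix_all(Gen_b k := [pos (Gen_b k), pos (Gen_a k), neg (Gen_a (k + 1))],
                  Gen_b (k + 1) := [pos (Gen_a (k + 1)), neg (Gen_a k), pos (Gen_b (k + 1))]))"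

definition u_aut :: "nat \<Rightarrow> nat \<Rightarrow> gen word set \<Rightarrow> gen word set" where
  "u_aut g i = free_extension (gens g) (F2g g) (\<lambda>x. F2g_class g (u_word g i x))"

section \<open>Abelianization\<close>

definition abelianization :: "('a, 'b) monoid_scheme \<Rightarrow> 'a set monoid" where
  "abelianization G = G Mod derived G (carrier G)"

definition ab_class :: "('a, 'b) monoid_scheme \<Rightarrow> 'a \<Rightarrow> 'a set" where
  "ab_class G x = derived G (carrier G) #>\<^bsub>G\<^esub> x"

text \<open>For an automorphism \<open>\<phi>\<close> of \<open>G\<close>, the image under \<open>\<phi>\<close> of the coset of \<open>x\<close> is the coset
  of \<open>\<phi> x\<close>.\<close>

definition ab_map :: "('a, 'b) monoid_scheme \<Rightarrow> ('a \<Rightarrow> 'a) \<Rightarrow> 'a set \<Rightarrow> 'a set" where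
  "ab_map G \<phi> = (\<lambda>C\<in>carrier (abelianization G). \<phi> ` C)"

text \<open>The basis of the abelianization of \<open>F2g g\<close> is indexed from 0: the classes of
  \<open>Gen_a 1, \<dots>, Gen_a g\<close> have indices \<open>0, \<dots>, g - 1\<close>, those of \<open>Gen_b 1, \<dots>, Gen_b g\<close> have indices
  \<open>g, \<dots>, 2g - 1\<close>.\<close>

definition ab_basis :: "nat \<Rightarrow> nat \<Rightarrow> gen word set set" where
  "ab_basis g k =
    ab_class (F2g g) (F2g_class g [pos (if k < g then Gen_a (k + 1) else Gen_b (k - g + 1))])"

definition of_coords :: "nat \<Rightarrow> int vec \<Rightarrow> gen word set set" where
  "of_coords g v =
    finprod (abelianization (F2g g))
      (\<lambda>k. ab_basis g k [^]\<^bsub>abelianization (F2g g)\<^esub> (v $ k)) {..<2 * g}"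

definition coords :: "nat \<Rightarrow> gen word set set \<Rightarrow> int vec" where
  "coords g = inv_into (carrier_vec (2 * g)) (of_coords g)"

definition \<pi> :: "nat \<Rightarrow> (gen word set \<Rightarrow> gen word set) \<Rightarrow> int mat" where
  "\<pi> g \<phi> = mat_of_cols (2 * g)
    (map (\<lambda>j. coords g (ab_map (F2g g) \<phi> (ab_basis g j))) [0..<2 * g])"

section \<open>The symplectic modular group\<close>

definition GL :: "nat \<Rightarrow> int mat monoid" where
  "GL n = units_of (ring_mat TYPE(int) n ())"

definition symp_form :: "nat \<Rightarrow> int vec \<Rightarrow> int vec \<Rightarrow> int" where
  "symp_form g x y = (\<Sum>i<g. x $ i * y $ (g + i) - x $ (g + i) * y $ i)"

text \<open>\<open>Sp g\<close> consists of matrices of size \<open>2g\<close>.\<close>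

definition Sp :: "nat \<Rightarrow> int mat monoid" where
  "Sp g = (GL (2 * g))\<lparr>carrier :=
    {M \<in> carrier (GL (2 * g)).
       \<forall>x\<in>carrier_vec (2 * g). \<forall>y\<in>carrier_vec (2 * g).
         symp_form g (M *\<^sub>v x) (M *\<^sub>v y) = symp_form g x y}\<rparr>"

end

theory Submission
  imports Defs
begin

text \<open>On \<open>H = \<int>\<^sup>2\<^sup>g\<close> each \<open>u_aut g i\<close> acts as the transvection \<open>x \<mapsto> x + \<langle>c, x\<rangle> c\<close>, where \<open>c\<close> is
  \<open>a\<^sub>1\<close> for \<open>i = 1\<close>, \<open>a\<^sub>g\<close> for \<open>i = 2g + 1\<close>, \<open>b\<^sub>k\<close> for \<open>i = 2k\<close> and \<open>a\<^sub>k - a\<^sub>k\<^sub>+\<^sub>1\<close> for \<open>i = 2k + 1\<close>.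
  Transvections preserve an alternating form, and automorphisms of the free group that preserve
  the pulled back form are closed under products and inverses, so the generators suffice.
  The abelianization is handled through exponent vectors: the coordinates of the coset of a word
  are its exponent sums.\<close>

section \<open>Groups given by presentations\<close>

lemma words_simps [simp]:
  "[] \<in> words S" "(x, s) # w \<in> words S \<longleftrightarrow> x \<in> S \<and> w \<in> words S"
  "u @ v \<in> words S \<longleftrightarrow> u \<in> words S \<and> v \<in> words S"
  by (auto simp: words_def)

lemma pres_rel_words: "(u, v) \<in> pres_rel S R \<Longrightarrow> u \<in> words S \<and> v \<in> words S"
  by (induction rule: pres_rel.induct) auto

lemma equiv_pres_rel: "equiv (words S) (pres_rel S R)"
proof (rule equivI)
  show "pres_rel S R \<subseteq> words S \<times> words S" using pres_rel_words by auto
  show "refl_on (words S) (pres_rel S R)" by (auto intro: refl_onI pres_rel.refl)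
  show "Relation.sym (pres_rel S R)" by (auto intro: symI pres_rel.sym)
  show "Relation.trans (pres_rel S R)" by (rule transI) (rule pres_rel.trans)
qed

lemma word_class_eq_iff:
  "u \<in> words S \<Longrightarrow> v \<in> words S \<Longrightarrow> word_class S R u = word_class S R v \<longleftrightarrow> (u, v) \<in> pres_rel S R"
  unfolding word_class_def by (rule eq_equiv_class_iff[OF equiv_pres_rel])

lemma word_class_self: "w \<in> words S \<Longrightarrow> w \<in> word_class S R w"
  by (simp add: word_class_def pres_rel.refl)

lemma carrier_presented_group: "carrier (presented_group S R) = word_class S R ` words S"
  by (auto simp: presented_group_def word_class_def quotient_def)

lemma word_class_closed [simp]:
  "w \<in> words S \<Longrightarrow> word_class S R w \<in> carrier (presented_group S R)"
  by (simp add: carrier_presented_group)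

lemma one_presented_group: "\<one>\<^bsub>presented_group S R\<^esub> = word_class S R []"
  by (simp add: presented_group_def)

text \<open>The product in \<open>presented_group\<close> is a union over all pairs of
  representatives. Compatibility of the relation with concatenation makes all classes in that union
  equal, and \<open>u\<close>, \<open>v\<close> themselves show that it is not empty.\<close>

lemma mult_word_class:
  assumes "u \<in> words S" "v \<in> words S"
  shows "word_class S R u \<otimes>\<^bsub>presented_group S R\<^esub> word_class S R v = word_class S R (u @ v)"
proof -
  have eq: "word_class S R (u' @ v') = word_class S R (u @ v)"
    if "u' \<in> word_class S R u" "v' \<in> word_class S R v" for u' v'
  proof -
    have uv: "(u, u') \<in> pres_rel S R" "(v, v') \<in> pres_rel S R"
      using that by (auto simp: word_class_def)
    then have "(u @ v, u' @ v') \<in> pres_rel S R" by (rule pres_rel.append)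
    moreover have "u' \<in> words S" "v' \<in> words S" using uv pres_rel_words by blast+
    ultimately show ?thesis using assms by (simp add: word_class_eq_iff pres_rel.sym)
  qed
  have "u \<in> word_class S R u" "v \<in> word_class S R v"
    using assms by (simp_all add: word_class_self)
  with eq have "(\<Union>u'\<in>word_class S R u. \<Union>v'\<in>word_class S R v. word_class S R (u' @ v'))
      = word_class S R (u @ v)" by blast
  then show ?thesis by (simp add: presented_group_def)
qed

lemma letter_inverse:
  assumes "x \<in> S"
  shows "word_class S R [(x, \<not> s)] \<otimes>\<^bsub>presented_group S R\<^esub> word_class S R [(x, s)]
    = \<one>\<^bsub>presented_group S R\<^esub>"
  using assms pres_rel.cancel[of x S "\<not> s" R]
  by (simp add: mult_word_class one_presented_group word_class_eq_iff)

lemma group_presented_group: "group (presented_group S R)" (is "group ?G")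
proof (rule groupI)
  show "\<one>\<^bsub>?G\<^esub> \<in> carrier ?G" by (simp add: one_presented_group)
next
  fix x y assume "x \<in> carrier ?G" "y \<in> carrier ?G"
  then show "x \<otimes>\<^bsub>?G\<^esub> y \<in> carrier ?G"
    by (auto simp: carrier_presented_group mult_word_class)
next
  fix x y z assume "x \<in> carrier ?G" "y \<in> carrier ?G" "z \<in> carrier ?G"
  then show "x \<otimes>\<^bsub>?G\<^esub> y \<otimes>\<^bsub>?G\<^esub> z = x \<otimes>\<^bsub>?G\<^esub> (y \<otimes>\<^bsub>?G\<^esub> z)"
    by (auto simp: carrier_presented_group mult_word_class)
next
  fix x assume "x \<in> carrier ?G"
  then show "\<one>\<^bsub>?G\<^esub> \<otimes>\<^bsub>?G\<^esub> x = x"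
    by (auto simp: carrier_presented_group mult_word_class one_presented_group)
next
  \<comment> \<open>A left inverse grows along the word: if \<open>v\<close> inverts
    \<open>w\<close>, then \<open>v\<close> followed by the opposite letter inverts
    \<open>(x, s) # w\<close>, the two new letters cancelling in the middle.\<close>
  have "\<exists>v\<in>words S. word_class S R v \<otimes>\<^bsub>?G\<^esub> word_class S R w = \<one>\<^bsub>?G\<^esub>" if "w \<in> words S" for w
    using that
  proof (induction w)
    case Nil
    then show ?case by (auto intro: bexI[of _ "[]"] simp: mult_word_class one_presented_group)
  next
    case (Cons a w)
    obtain x s where a: "a = (x, s)" by (cases a)
    from Cons obtain v where v: "v \<in> words S"
      "word_class S R v \<otimes>\<^bsub>?G\<^esub> word_class S R w = \<one>\<^bsub>?G\<^esub>" by (auto simp: a)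
    have x: "x \<in> S" "w \<in> words S" using Cons.prems by (auto simp: a)
    have "([(x, \<not> s), (x, s)], []) \<in> pres_rel S R"
      using pres_rel.cancel[of x S "\<not> s" R] x by simp
    then have "((v @ [(x, \<not> s), (x, s)]) @ w, (v @ []) @ w) \<in> pres_rel S R"
      using v x by (intro pres_rel.append pres_rel.refl) auto
    then have "word_class S R (v @ [(x, \<not> s), (x, s)] @ w) = word_class S R (v @ w)"
      using v x by (subst word_class_eq_iff) auto
    with v x show ?case
      by (intro bexI[of _ "v @ [(x, \<not> s)]"]) (auto simp: a mult_word_class)
  qed
  then show "\<exists>y\<in>carrier ?G. y \<otimes>\<^bsub>?G\<^esub> x = \<one>\<^bsub>?G\<^esub>" if "x \<in> carrier ?G" for x
    using that word_class_closed[of _ S R] unfolding carrier_presented_group by blast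
qed

text \<open>Words are products of letters, and a negative letter is the group inverse of the
  positive one. This later reduces claims about the braid group to the \<sigma> generators.\<close>

lemma presented_group_generate:
  "carrier (presented_group S R) =
    generate (presented_group S R) ((\<lambda>x. word_class S R [pos x]) ` S)" (is "carrier ?G = generate _ ?X")
proof
  interpret G: group ?G by (rule group_presented_group)
  show "generate ?G ?X \<subseteq> carrier ?G"
    by (rule G.generate_incl) auto
  have "word_class S R w \<in> generate ?G ?X" if "w \<in> words S" for w
    using that
  proof (induction w)
    case Nil
    show ?case using generate.one[of ?G] by (simp add: one_presented_group)
  next
    case (Cons a w)
    obtain x s where a: "a = (x, s)" by (cases a)
    have x: "x \<in> S" "w \<in> words S" using Cons.prems by (auto simp: a)
    have "word_class S R [(x, s)] \<in> generate ?G ?X"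
    proof (cases s)
      case True
      then show ?thesis using x by (auto intro: generate.incl)
    next
      case False
      have "word_class S R [neg x] = inv\<^bsub>?G\<^esub> word_class S R [pos x]"
        using x letter_inverse[of x S R True] by (intro G.inv_equality[symmetric]) auto
      with False x show ?thesis by (auto intro: generate.inv)
    qed
    from generate.eng[OF this Cons.IH] x show ?case by (simp add: a mult_word_class)
  qed
  then show "carrier ?G \<subseteq> generate ?G ?X" by (auto simp: carrier_presented_group)
qed

lemma (in group) hom_eq_on_generate:
  assumes "h \<in> hom G H" "k \<in> hom G H" "group H" "X \<subseteq> carrier G"
    and "\<And>x. x \<in> X \<Longrightarrow> h x = k x" "y \<in> generate G X"
  shows "h y = k y"
proof -
  interpret h: group_hom G H h
    by (intro group_hom.intro group_hom_axioms.intro is_group assms(1,3))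
  interpret k: group_hom G H k
    by (intro group_hom.intro group_hom_axioms.intro is_group assms(2,3))
  show ?thesis
    using assms(6)
  proof induction
    case one
    show ?case by (simp only: h.hom_one k.hom_one)
  next
    case (incl a)
    then show ?case by (rule assms(5))
  next
    case (inv a)
    then have "a \<in> carrier G" "h a = k a" using assms(4,5) by auto
    then show ?case by (simp only: h.hom_inv k.hom_inv)
  next
    case (eng a b)
    have "a \<in> carrier G" "b \<in> carrier G"
      using eng.hyps by (simp_all add: generate_in_carrier[OF assms(4)])
    then show ?case by (simp only: h.hom_mult k.hom_mult eng.IH)
  qed
qed

text \<open>Uniqueness half of the universal property of the free group; existence is
  \<open>free_extension_hom\<close>. Together they let identities between homomorphisms be checked
  on generators.\<close>

lemma free_group_hom_eqI:
  assumes "h \<in> hom (free_group S) H" "k \<in> hom (free_group S) H" "group H"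
    and "\<And>x. x \<in> S \<Longrightarrow> h (word_class S {} [pos x]) = k (word_class S {} [pos x])"
    and "y \<in> carrier (free_group S)"
  shows "h y = k y"
  by (rule group.hom_eq_on_generate[OF group_presented_group assms(1-3),
        where X = "(\<lambda>x. word_class S {} [pos x]) ` S"])
    (use assms(4,5) presented_group_generate in auto)

section \<open>Evaluation of words and homomorphisms out of a free group\<close>

context group
begin

lemma eval_word_Nil [simp]: "eval_word G h [] = \<one>"
  by (simp add: eval_word_def)

lemma eval_word_Cons [simp]:
  "eval_word G h ((x, s) # w) = (if s then h x else inv h x) \<otimes> eval_word G h w"
  by (simp add: eval_word_def)

lemma eval_word_closed:
  "h ` S \<subseteq> carrier G \<Longrightarrow> w \<in> words S \<Longrightarrow> eval_word G h w \<in> carrier G"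
  by (induction w) (auto simp: image_subset_iff)

lemma eval_word_append:
  assumes "h ` S \<subseteq> carrier G" "u \<in> words S" "v \<in> words S"
  shows "eval_word G h (u @ v) = eval_word G h u \<otimes> eval_word G h v"
  using assms(2)
proof (induction u)
  case Nil
  show ?case using eval_word_closed[OF assms(1,3)] by simp
next
  case (Cons a u)
  obtain x s where a: "a = (x, s)" by (cases a)
  have "h x \<in> carrier G" "u \<in> words S" using Cons.prems assms(1) by (auto simp: a)
  then show ?case
    using Cons.IH eval_word_closed[OF assms(1)] assms(3) by (simp add: a m_assoc)
qed

text \<open>With an empty set of relations, only cancellation of adjacent inverse letters has to be
  respected. This makes the representative picked by \<open>SOME\<close> in
  \<open>free_extension\<close> irrelevant.\<close>

lemma eval_word_free_rel:
  assumes "h ` S \<subseteq> carrier G" "(u, v) \<in> pres_rel S {}"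
  shows "eval_word G h u = eval_word G h v"
  using assms(2)
proof induction
  case (cancel x s)
  then have "h x \<in> carrier G" using assms(1) by auto
  then show ?case by simp
next
  case (append u u' v v')
  have "u \<in> words S" "v \<in> words S" "u' \<in> words S" "v' \<in> words S"
    using append.hyps[THEN pres_rel_words] by simp_all
  then show ?case
    by (simp only: eval_word_append[OF assms(1)] append.IH)
qed simp_all

lemma free_extension_word_class:
  assumes "h ` S \<subseteq> carrier G" "w \<in> words S"
  shows "free_extension S G h (word_class S {} w) = eval_word G h w"
proof -
  have "(SOME v. v \<in> word_class S {} w) \<in> word_class S {} w"
    using word_class_self[OF assms(2)] by (rule someI)
  then have "(w, SOME v. v \<in> word_class S {} w) \<in> pres_rel S {}"
    by (simp add: word_class_def)
  from eval_word_free_rel[OF assms(1) this] assms(2) show ?thesis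
    by (simp add: free_extension_def)
qed

lemma free_extension_hom:
  assumes "h ` S \<subseteq> carrier G"
  shows "free_extension S G h \<in> hom (free_group S) G"
proof (rule homI)
  fix x assume "x \<in> carrier (free_group S)"
  then show "free_extension S G h x \<in> carrier G"
    using assms by (auto simp: carrier_presented_group free_extension_word_class eval_word_closed[OF assms])
next
  fix x y assume "x \<in> carrier (free_group S)" "y \<in> carrier (free_group S)"
  then obtain u v where "x = word_class S {} u" "u \<in> words S" "y = word_class S {} v" "v \<in> words S"
    by (auto simp: carrier_presented_group)
  then show "free_extension S G h (x \<otimes>\<^bsub>free_group S\<^esub> y)
      = free_extension S G h x \<otimes> free_extension S G h y"
    by (simp add: mult_word_class free_extension_word_class[OF assms] eval_word_append[OF assms])
qed

end

section \<open>Integer vectors and the symplectic form\<close>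

abbreviation Zvec :: "nat \<Rightarrow> int vec monoid" where
  "Zvec n \<equiv> monoid_vec TYPE(int) n"

lemma group_Zvec: "group (Zvec n)"
  by (rule comm_group.axioms(2)[OF comm_group_vec])

lemma inv_Zvec:
  assumes "v \<in> carrier_vec n"
  shows "inv\<^bsub>Zvec n\<^esub> v = - v"
  using assms by (intro group.inv_equality[OF group_Zvec]) (auto simp: monoid_vec_simps)

lemma int_pow_Zvec:
  assumes "v \<in> carrier_vec n"
  shows "v [^]\<^bsub>Zvec n\<^esub> (k :: int) = k \<cdot>\<^sub>v v"
proof -
  have pow: "v [^]\<^bsub>Zvec n\<^esub> (m :: nat) = int m \<cdot>\<^sub>v v" for m
    using assms
    by (induction m) (auto simp: nat_pow_def monoid_vec_simps algebra_simps intro!: eq_vecI)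
  show ?thesis
    unfolding int_pow_def2
    using assms by (auto simp: pow inv_Zvec intro!: eq_vecI)
qed

lemma symp_form_linear [simp]:
  assumes "x \<in> carrier_vec (2 * g)" "y \<in> carrier_vec (2 * g)" "z \<in> carrier_vec (2 * g)"
  shows "symp_form g (x + y) z = symp_form g x z + symp_form g y z"
    and "symp_form g (x - y) z = symp_form g x z - symp_form g y z"
    and "symp_form g z (x + y) = symp_form g z x + symp_form g z y"
    and "symp_form g (a \<cdot>\<^sub>v x) z = a * symp_form g x z"
    and "symp_form g z (a \<cdot>\<^sub>v x) = a * symp_form g z x"
  using assms
  by (auto simp: symp_form_def sum.distrib[symmetric] sum_subtractf[symmetric] sum_distrib_left algebra_simps
      intro!: sum.cong)

lemma symp_form_alternating [simp]: "symp_form g x x = 0"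
  by (simp add: symp_form_def mult.commute)

lemma symp_form_antisym: "symp_form g x y = - symp_form g y x"
  by (simp add: symp_form_def sum_negf[symmetric] algebra_simps)

section \<open>Symplectic transvections\<close>

definition transvection :: "nat \<Rightarrow> int vec \<Rightarrow> int vec \<Rightarrow> int vec" where
  "transvection g c x = x + symp_form g c x \<cdot>\<^sub>v c"

text \<open>Expanding by bilinearity leaves \<langle>x, y\<rangle> plus the cross terms \<langle>c,
  y\<rangle>\<langle>x, c\<rangle> and \<langle>c, x\<rangle>\<langle>c, y\<rangle>, which cancel by
  antisymmetry; the last term contains \<langle>c, c\<rangle> = 0.\<close>

lemma transvection_symp_form:
  assumes "c \<in> carrier_vec (2 * g)" "x \<in> carrier_vec (2 * g)" "y \<in> carrier_vec (2 * g)"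
  shows "symp_form g (transvection g c x) (transvection g c y) = symp_form g x y"
  using assms symp_form_antisym[of g x c]
  by (simp add: transvection_def algebra_simps)

lemma transvection_hom:
  assumes "c \<in> carrier_vec (2 * g)"
  shows "transvection g c \<in> hom (Zvec (2 * g)) (Zvec (2 * g))"
proof (rule homI)
  fix x y assume "x \<in> carrier (Zvec (2 * g))" "y \<in> carrier (Zvec (2 * g))"
  with assms show "transvection g c (x \<otimes>\<^bsub>Zvec (2 * g)\<^esub> y)
      = transvection g c x \<otimes>\<^bsub>Zvec (2 * g)\<^esub> transvection g c y"
    by (auto simp: monoid_vec_simps transvection_def algebra_simps intro!: eq_vecI)
qed (use assms in \<open>auto simp: monoid_vec_simps transvection_def\<close>)

text \<open>Only the summand with index \<open>k\<close> survives. With indices from 0, the two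
  cases are pairing with the class of \<open>Gen_a (k + 1)\<close> and with that of
  \<open>Gen_b (k + 1)\<close>.\<close>

lemma symp_form_unit_vec:
  assumes "k < g" "y \<in> carrier_vec (2 * g)"
  shows "symp_form g (unit_vec (2 * g) k) y = y $ (g + k)"
    and "symp_form g (unit_vec (2 * g) (g + k)) y = - y $ k"
proof -
  have "symp_form g (unit_vec (2 * g) k) y = (\<Sum>i<g. if i = k then y $ (g + k) else 0)"
    unfolding symp_form_def using assms by (intro sum.cong) auto
  then show "symp_form g (unit_vec (2 * g) k) y = y $ (g + k)" using assms by simp
  have "symp_form g (unit_vec (2 * g) (g + k)) y = (\<Sum>i<g. if i = k then - y $ k else 0)"
    unfolding symp_form_def using assms by (intro sum.cong) auto
  then show "symp_form g (unit_vec (2 * g) (g + k)) y = - y $ k" using assms by simp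
qed


section \<open>The abelianization of the free group\<close>

definition gen_vec :: "nat \<Rightarrow> gen \<Rightarrow> int vec" where
  "gen_vec g x = (case x of Gen_a k \<Rightarrow> unit_vec (2 * g) (k - 1)
    | Gen_b k \<Rightarrow> unit_vec (2 * g) (g + (k - 1)))"

text \<open>The exponent-sum map from the free group to the integer vectors. By
  \<open>coords_ab_class\<close> it is the coset map followed by \<open>coords\<close>, so that most
  later arguments need no cosets.\<close>

definition exponents :: "nat \<Rightarrow> gen word set \<Rightarrow> int vec" where
  "exponents g = free_extension (gens g) (Zvec (2 * g)) (gen_vec g)"

definition basis_gen :: "nat \<Rightarrow> nat \<Rightarrow> gen" where
  "basis_gen g k = (if k < g then Gen_a (k + 1) else Gen_b (k - g + 1))"

lemma gens_eq_basis_gen: "gens g = basis_gen g ` {..<2 * g}"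
proof
  have "Gen_a k \<in> basis_gen g ` {..<2 * g}" if "k \<in> {1..g}" for k
    using that by (intro image_eqI[where x = "k - 1"]) (auto simp: basis_gen_def)
  moreover have "Gen_b k \<in> basis_gen g ` {..<2 * g}" if "k \<in> {1..g}" for k
    using that by (intro image_eqI[where x = "g + (k - 1)"]) (auto simp: basis_gen_def)
  ultimately show "gens g \<subseteq> basis_gen g ` {..<2 * g}" by (auto simp: gens_def)
  show "basis_gen g ` {..<2 * g} \<subseteq> gens g" by (auto simp: gens_def basis_gen_def)
qed

lemma gen_vec_basis_gen: "k < 2 * g \<Longrightarrow> gen_vec g (basis_gen g k) = unit_vec (2 * g) k"
  by (simp add: gen_vec_def basis_gen_def)

lemma gen_vec_in_Zvec: "gen_vec g ` gens g \<subseteq> carrier (Zvec (2 * g))"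
  by (auto simp: gens_eq_basis_gen gen_vec_basis_gen monoid_vec_simps)

lemma group_F2g: "group (F2g g)"
  unfolding F2g_def by (rule group_presented_group)

lemma F2g_class_closed: "w \<in> words (gens g) \<Longrightarrow> F2g_class g w \<in> carrier (F2g g)"
  by (simp add: F2g_class_def F2g_def)

lemma exponents_hom: "exponents g \<in> hom (F2g g) (Zvec (2 * g))"
  unfolding exponents_def F2g_def by (rule group.free_extension_hom[OF group_Zvec gen_vec_in_Zvec])

lemma exponents_closed: "p \<in> carrier (F2g g) \<Longrightarrow> exponents g p \<in> carrier_vec (2 * g)"
  using hom_in_carrier[OF exponents_hom] by (simp add: monoid_vec_simps)

lemma exponents_class:
  "w \<in> words (gens g) \<Longrightarrow> exponents g (F2g_class g w) = eval_word (Zvec (2 * g)) (gen_vec g) w"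
  unfolding exponents_def F2g_class_def
  by (rule group.free_extension_word_class[OF group_Zvec gen_vec_in_Zvec])

lemma exponents_gen:
  assumes "x \<in> gens g"
  shows "exponents g (F2g_class g [pos x]) = gen_vec g x"
proof -
  interpret Z: group "Zvec (2 * g)" by (rule group_Zvec)
  have "gen_vec g x \<in> carrier (Zvec (2 * g))" using assms gen_vec_in_Zvec by blast
  then show ?thesis using assms by (simp add: exponents_class)
qed

lemma F2g_hom_eqI:
  assumes "h \<in> hom (F2g g) H" "k \<in> hom (F2g g) H" "group H"
    and "\<And>x. x \<in> gens g \<Longrightarrow> h (F2g_class g [pos x]) = k (F2g_class g [pos x])"
    and "y \<in> carrier (F2g g)"
  shows "h y = k y"
  using free_group_hom_eqI[of h "gens g" H k y] assms by (simp add: F2g_def F2g_class_def)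

text \<open>Lets any integer vector be replaced by the exponent vector of a group element, so that
  statements about matrices become statements about automorphisms.\<close>

lemma exponents_surj: 
  assumes "v \<in> carrier_vec (2 * g)"
  obtains p where "p \<in> carrier (F2g g)" "exponents g p = v"
proof -
  interpret E: group_hom "F2g g" "Zvec (2 * g)" "exponents g"
    by (intro group_hom.intro group_hom_axioms.intro group_F2g group_Zvec exponents_hom)
  \<comment> \<open>The preimage is built one coordinate at a time: the first \<open>m\<close>
    entries are already right, and multiplying by the power \<open>v $ m\<close> of the next
    generator sets entry \<open>m\<close>.\<close>
  have "\<exists>p\<in>carrier (F2g g). exponents g p = vec (2 * g) (\<lambda>k. if k < m then v $ k else 0)"
    if "m \<le> 2 * g" for m
    using that
  proof (induction m)
    case 0
    show ?case
      by (rule bexI[of _ "\<one>\<^bsub>F2g g\<^esub>"]) (auto simp: monoid_vec_simps)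
  next
    case (Suc m)
    then obtain p where p: "p \<in> carrier (F2g g)"
      "exponents g p = vec (2 * g) (\<lambda>k. if k < m then v $ k else 0)" by auto
    have m: "basis_gen g m \<in> gens g" using Suc.prems by (auto simp: gens_eq_basis_gen)
    define b where "b = F2g_class g [pos (basis_gen g m)]"
    have b: "b \<in> carrier (F2g g)" using m by (simp add: b_def F2g_class_closed)
    have "exponents g (b [^]\<^bsub>F2g g\<^esub> (v $ m)) = v $ m \<cdot>\<^sub>v unit_vec (2 * g) m"
      using Suc.prems
      by (simp add: E.hom_int_pow b int_pow_Zvec exponents_closed)
        (simp add: b_def exponents_gen m gen_vec_basis_gen)
    then have "exponents g (p \<otimes>\<^bsub>F2g g\<^esub> b [^]\<^bsub>F2g g\<^esub> (v $ m))
        = vec (2 * g) (\<lambda>k. if k < m then v $ k else 0) + v $ m \<cdot>\<^sub>v unit_vec (2 * g) m"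
      using p b by (simp add: monoid_vec_simps)
    also have "\<dots> = vec (2 * g) (\<lambda>k. if k < Suc m then v $ k else 0)"
      using Suc.prems by (intro eq_vecI) (auto simp: less_Suc_eq)
    finally show ?case using p(1) b by (intro bexI) (assumption, simp)
  qed
  from this[of "2 * g"] obtain p where "p \<in> carrier (F2g g)"
    "exponents g p = vec (2 * g) (\<lambda>k. if k < 2 * g then v $ k else 0)" by auto
  moreover have "vec (2 * g) (\<lambda>k. if k < 2 * g then v $ k else 0) = v" using assms by auto
  ultimately show ?thesis using that by simp
qed

section \<open>Cosets of the derived subgroup and their coordinates\<close>

lemma (in group) ab_class_hom: "ab_class G \<in> hom G (abelianization G)"
  using normal.r_coset_hom_Mod[OF derived_self_is_normal]
  by (simp add: ab_class_def[abs_def] abelianization_def)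

lemma (in group) comm_group_abelianization: "comm_group (abelianization G)"
  unfolding abelianization_def by (rule derived_quot_is_comm_group)

text \<open>Homomorphisms to a commutative group factor through the abelianization: they map the
  derived subgroup onto that of the image, which is trivial.\<close>

lemma (in group) ab_class_eqD:
  assumes "h \<in> hom G H" "comm_group H" "p \<in> carrier G" "q \<in> carrier G"
    and "ab_class G p = ab_class G q"
  shows "h p = h q"
proof -
  interpret H: comm_group H by fact
  interpret h: group_hom G H h
    by (intro group_hom.intro group_hom_axioms.intro is_group H.is_group assms(1))
  have D: "subgroup (derived G (carrier G)) G" by (rule derived_is_subgroup) simp
  have "p \<in> ab_class G q"
    using rcos_self[OF assms(3) D] assms(5) by (simp add: ab_class_def)
  then obtain d where d: "d \<in> derived G (carrier G)" "p = d \<otimes> q"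
    by (auto simp: ab_class_def r_coset_def)
  have "h d \<in> derived H (h ` carrier G)"
    using d by (subst h.derived_img) auto
  also have "derived H (h ` carrier G) = {\<one>\<^bsub>H\<^esub>}"
    by (rule H.derived_eq_singleton) auto
  finally show ?thesis using d subgroup.mem_carrier[OF D] assms(4) by simp
qed

lemma (in group) ab_map_ab_class:
  assumes "\<phi> \<in> auto G" "p \<in> carrier G"
  shows "ab_map G \<phi> (ab_class G p) = ab_class G (\<phi> p)"
proof -
  have "\<phi> \<in> hom G G" and surj: "\<phi> ` carrier G = carrier G"
    using assms by (auto simp: auto_def Bij_def bij_betw_def)
  then interpret h: group_hom G G \<phi>
    by (intro group_hom.intro group_hom_axioms.intro is_group)
  \<comment> \<open>Surjectivity of \<phi> gives equality here, so the image of a coset is a whole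
    coset and not just a subset of one.\<close>
  have D: "\<phi> ` derived G (carrier G) = derived G (carrier G)"
    using h.derived_img[of "carrier G"] surj by simp
  have sub: "derived G (carrier G) \<subseteq> carrier G" by (rule derived_in_carrier) simp
  have "\<phi> ` ab_class G p = (\<lambda>d. d \<otimes> \<phi> p) ` \<phi> ` derived G (carrier G)"
    using sub assms(2) by (force simp: ab_class_def r_coset_def image_image subset_iff)
  then show ?thesis
    using hom_in_carrier[OF ab_class_hom assms(2)] D by (auto simp: ab_map_def ab_class_def r_coset_def)
qed

lemma ab_basis_eq: "ab_basis g k = ab_class (F2g g) (F2g_class g [pos (basis_gen g k)])"
  by (simp add: ab_basis_def basis_gen_def)

lemma ab_basis_closed:
  assumes "k < 2 * g"
  shows "ab_basis g k \<in> carrier (abelianization (F2g g))"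
proof -
  have "basis_gen g k \<in> gens g" using assms by (auto simp: gens_eq_basis_gen)
  then show ?thesis
    unfolding ab_basis_eq
    by (intro hom_in_carrier[OF group.ab_class_hom[OF group_F2g]] F2g_class_closed) simp
qed

text \<open>Commutativity of the abelianization allows the product of the powers to be split factor
  by factor.\<close>

lemma of_coords_hom: "of_coords g \<in> hom (Zvec (2 * g)) (abelianization (F2g g))"
proof -
  interpret A: comm_group "abelianization (F2g g)"
    by (rule group.comm_group_abelianization[OF group_F2g])
  show ?thesis
  proof (rule homI)
    fix x assume "x \<in> carrier (Zvec (2 * g))"
    show "of_coords g x \<in> carrier (abelianization (F2g g))"
      unfolding of_coords_def by (rule A.finprod_closed) (auto simp: ab_basis_closed)
  next
    fix x y assume "x \<in> carrier (Zvec (2 * g))" "y \<in> carrier (Zvec (2 * g))"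
    then have xy: "x \<in> carrier_vec (2 * g)" "y \<in> carrier_vec (2 * g)"
      by (simp_all add: monoid_vec_simps)
    have "of_coords g (x \<otimes>\<^bsub>Zvec (2 * g)\<^esub> y) =
      finprod (abelianization (F2g g))
        (\<lambda>k. ab_basis g k [^]\<^bsub>abelianization (F2g g)\<^esub> (x $ k)
          \<otimes>\<^bsub>abelianization (F2g g)\<^esub> ab_basis g k [^]\<^bsub>abelianization (F2g g)\<^esub> (y $ k)) {..<2 * g}"
      unfolding of_coords_def using xy
      by (intro A.finprod_cong')
        (auto simp: monoid_vec_simps ab_basis_closed A.int_pow_mult)
    then show "of_coords g (x \<otimes>\<^bsub>Zvec (2 * g)\<^esub> y)
        = of_coords g x \<otimes>\<^bsub>abelianization (F2g g)\<^esub> of_coords g y"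
      unfolding of_coords_def by (subst (asm) A.finprod_multf) (auto simp: ab_basis_closed)
  qed
qed

lemma of_coords_unit_vec:
  assumes "k < 2 * g"
  shows "of_coords g (unit_vec (2 * g) k) = ab_basis g k"
proof -
  interpret A: comm_group "abelianization (F2g g)"
    by (rule group.comm_group_abelianization[OF group_F2g])
  have "of_coords g (unit_vec (2 * g) k) = finprod (abelianization (F2g g))
      (\<lambda>j. if k = j then ab_basis g j else \<one>\<^bsub>abelianization (F2g g)\<^esub>) {..<2 * g}"
    unfolding of_coords_def using assms
    by (intro A.finprod_cong') (auto simp: ab_basis_closed A.int_pow_1)
  also have "\<dots> = ab_basis g k"
    using assms by (intro A.finprod_singleton) (auto simp: ab_basis_closed)
  finally show ?thesis .
qed

text \<open>Both sides are homomorphisms in \<open>p\<close>, and on a generator both give the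
  corresponding element of \<open>ab_basis\<close>.\<close>

lemma of_coords_exponents:
  assumes "p \<in> carrier (F2g g)"
  shows "of_coords g (exponents g p) = ab_class (F2g g) p"
proof -
  have "(of_coords g \<circ> exponents g) p = ab_class (F2g g) p"
  proof (rule F2g_hom_eqI[OF _ group.ab_class_hom[OF group_F2g] _ _ assms])
    show "of_coords g \<circ> exponents g \<in> hom (F2g g) (abelianization (F2g g))"
      by (rule hom_compose[OF exponents_hom of_coords_hom])
    show "group (abelianization (F2g g))"
      by (rule comm_group.axioms(2)[OF group.comm_group_abelianization[OF group_F2g]])
    fix x assume x: "x \<in> gens g"
    then obtain k where "x = basis_gen g k" "k < 2 * g" by (auto simp: gens_eq_basis_gen)
    with x show "(of_coords g \<circ> exponents g) (F2g_class g [pos x])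
        = ab_class (F2g g) (F2g_class g [pos x])"
      by (simp add: exponents_gen gen_vec_basis_gen of_coords_unit_vec ab_basis_eq)
  qed
  then show ?thesis by simp
qed

text \<open>Justifies the use of \<open>inv_into\<close> in \<open>coords\<close>. For injectivity
  of \<open>of_coords\<close>, two vectors are lifted to group elements; if their cosets agree, then
  so do their exponent vectors, since \<open>exponents\<close> factors through the
  abelianization.\<close>

lemma coords_ab_class:
  assumes "p \<in> carrier (F2g g)"
  shows "coords g (ab_class (F2g g) p) = exponents g p"
proof -
  have "inj_on (of_coords g) (carrier_vec (2 * g))"
  proof (rule inj_onI)
    fix v w assume "v \<in> carrier_vec (2 * g)" "w \<in> carrier_vec (2 * g)"
      and eq: "of_coords g v = of_coords g w"
    then obtain p q where "p \<in> carrier (F2g g)" "exponents g p = v"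
      "q \<in> carrier (F2g g)" "exponents g q = w" by (metis exponents_surj)
    with eq show "v = w"
      using group.ab_class_eqD[OF group_F2g exponents_hom comm_group_vec]
      by (metis of_coords_exponents)
  qed
  from inv_into_f_f[OF this exponents_closed[OF assms]] show ?thesis
    by (simp add: coords_def of_coords_exponents assms)
qed

section \<open>The matrix of an automorphism\<close>

lemma pi_carrier: "\<pi> g \<phi> \<in> carrier_mat (2 * g) (2 * g)"
  by (simp add: \<pi>_def carrier_matI)

text \<open>Links the matrix to the automorphism. Both sides are homomorphisms in \<open>p\<close>;
  on the generator numbered \<open>j\<close> the left side is column \<open>j\<close> of the matrix,
  which was defined as the coordinates of the image of that generator's coset.\<close>

lemma pi_exponents:
  assumes "\<phi> \<in> auto (F2g g)" "p \<in> carrier (F2g g)"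
  shows "\<pi> g \<phi> *\<^sub>v exponents g p = exponents g (\<phi> p)"
proof -
  have phi: "\<phi> \<in> hom (F2g g) (F2g g)" using assms(1) by (simp add: auto_def)
  have "(*\<^sub>v) (\<pi> g \<phi>) \<in> hom (Zvec (2 * g)) (Zvec (2 * g))"
    using pi_carrier[of g \<phi>]
    by (intro homI) (auto simp: monoid_vec_simps mult_add_distrib_mat_vec)
  then have M: "(*\<^sub>v) (\<pi> g \<phi>) \<circ> exponents g \<in> hom (F2g g) (Zvec (2 * g))"
    by (rule hom_compose[OF exponents_hom])
  have "((*\<^sub>v) (\<pi> g \<phi>) \<circ> exponents g) p = (exponents g \<circ> \<phi>) p"
  proof (rule F2g_hom_eqI[OF M hom_compose[OF phi exponents_hom] group_Zvec _ assms(2)])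
    fix x assume x: "x \<in> gens g"
    then obtain j where j: "x = basis_gen g j" "j < 2 * g" by (auto simp: gens_eq_basis_gen)
    define b where "b = F2g_class g [pos x]"
    have b: "b \<in> carrier (F2g g)" using x by (simp add: b_def F2g_class_closed)
    then have phib: "\<phi> b \<in> carrier (F2g g)" by (rule hom_in_carrier[OF phi])
    have "\<pi> g \<phi> *\<^sub>v exponents g b = col (\<pi> g \<phi>) j"
      using j x pi_carrier[of g \<phi>]
      by (intro eq_vecI) (auto simp: b_def exponents_gen gen_vec_basis_gen)
    also have "\<dots> = exponents g (\<phi> b)"
    proof -
      have "coords g (ab_map (F2g g) \<phi> (ab_basis g j)) = exponents g (\<phi> b)"
        using group.ab_map_ab_class[OF group_F2g assms(1) b]
        by (simp add: ab_basis_eq b_def[unfolded j(1), symmetric] coords_ab_class phib)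
      then show ?thesis
        unfolding \<pi>_def using j exponents_closed[OF phib] by (subst col_mat_of_cols) simp_all
    qed
    finally show "((*\<^sub>v) (\<pi> g \<phi>) \<circ> exponents g) (F2g_class g [pos x])
        = (exponents g \<circ> \<phi>) (F2g_class g [pos x])" by (simp add: b_def)
  qed
  then show ?thesis by simp
qed


text \<open>Exponent vectors include all unit vectors, and these read off the columns.\<close>

lemma int_mat_eq_by_exponents:
  assumes "A \<in> carrier_mat (2 * g) (2 * g)" "B \<in> carrier_mat (2 * g) (2 * g)"
    and "\<And>p. p \<in> carrier (F2g g) \<Longrightarrow> A *\<^sub>v exponents g p = B *\<^sub>v exponents g p"
  shows "A = B"
proof (rule mat_col_eqI)
  fix j assume "j < dim_col B"
  then have j: "j < 2 * g" using assms by auto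
  obtain p where "p \<in> carrier (F2g g)" "exponents g p = unit_vec (2 * g) j"
    using exponents_surj[of "unit_vec (2 * g) j" g] by auto
  then have eq: "A *\<^sub>v unit_vec (2 * g) j = B *\<^sub>v unit_vec (2 * g) j" using assms(3) by metis
  have "C *\<^sub>v unit_vec (2 * g) j = col C j" if "C \<in> carrier_mat (2 * g) (2 * g)" for C :: "int mat"
    using that j by (intro eq_vecI) auto
  with eq assms(1,2) show "col A j = col B j" by metis
qed (use assms in auto)

lemma pi_mult_eq_one:
  assumes "\<phi> \<in> auto (F2g g)" "\<psi> \<in> auto (F2g g)"
    and "\<And>p. p \<in> carrier (F2g g) \<Longrightarrow> \<phi> (\<psi> p) = p"
  shows "\<pi> g \<phi> * \<pi> g \<psi> = 1\<^sub>m (2 * g)"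
proof (rule int_mat_eq_by_exponents)
  fix p assume p: "p \<in> carrier (F2g g)"
  have "\<psi> \<in> hom (F2g g) (F2g g)" using assms(2) by (simp add: auto_def)
  then have "\<psi> p \<in> carrier (F2g g)" using p by (rule hom_in_carrier)
  then show "\<pi> g \<phi> * \<pi> g \<psi> *\<^sub>v exponents g p = 1\<^sub>m (2 * g) *\<^sub>v exponents g p"
    using p exponents_closed[OF p]
    by (simp add: assoc_mult_mat_vec[OF pi_carrier pi_carrier] pi_exponents assms)
qed (simp_all add: mult_carrier_mat[OF pi_carrier pi_carrier])

text \<open>The inverse automorphism supplies the inverse matrix, by \<open>pi_mult_eq_one\<close>
  applied in both orders.\<close>

lemma pi_in_GL:
  assumes "\<phi> \<in> auto (F2g g)"
  shows "\<pi> g \<phi> \<in> carrier (GL (2 * g))"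
proof -
  \<comment> \<open>The restriction is there because members of \<open>auto\<close> are extensional,
    that is, \<open>undefined\<close> outside the carrier.\<close>
  let ?\<psi> = "restrict (inv_into (carrier (F2g g)) \<phi>) (carrier (F2g g))"
  have bij: "\<phi> \<in> Bij (carrier (F2g g))" using assms by (simp add: auto_def)
  then have psi: "?\<psi> \<in> auto (F2g g)"
    using assms group.restrict_inv_into_hom[OF group_F2g, of \<phi>]
    by (auto simp: auto_def restrict_inv_into_Bij)
  have bb: "bij_betw \<phi> (carrier (F2g g)) (carrier (F2g g))" using bij by (simp add: Bij_def)
  have "\<pi> g \<phi> * \<pi> g ?\<psi> = 1\<^sub>m (2 * g)"
    by (rule pi_mult_eq_one[OF assms psi]) (simp add: bij_betw_inv_into_right[OF bb])
  moreover have "\<pi> g ?\<psi> * \<pi> g \<phi> = 1\<^sub>m (2 * g)"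
    by (rule pi_mult_eq_one[OF psi assms])
      (simp add: bij_betw_inv_into_left[OF bb] bij_betwE[OF bb])
  ultimately show ?thesis
    using pi_carrier unfolding GL_def units_of_carrier Units_def ring_mat_simps by blast
qed

section \<open>Automorphisms inducing isometries of the symplectic form\<close>

text \<open>Invariance of the form pulled back along \<open>exponents\<close>. Phrased on group
  elements, it passes to products and inverses by composing maps, without multiplying
  matrices.\<close>

definition symp_isometry :: "nat \<Rightarrow> (gen word set \<Rightarrow> gen word set) \<Rightarrow> bool" where
  "symp_isometry g \<phi> \<longleftrightarrow> (\<forall>p\<in>carrier (F2g g). \<forall>q\<in>carrier (F2g g).
    symp_form g (exponents g (\<phi> p)) (exponents g (\<phi> q)) = symp_form g (exponents g p) (exponents g q))"

lemma pi_in_Sp: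
  assumes "\<phi> \<in> auto (F2g g)" "symp_isometry g \<phi>"
  shows "\<pi> g \<phi> \<in> carrier (Sp g)"
proof -
  have "symp_form g (\<pi> g \<phi> *\<^sub>v x) (\<pi> g \<phi> *\<^sub>v y) = symp_form g x y"
    if xy: "x \<in> carrier_vec (2 * g)" "y \<in> carrier_vec (2 * g)" for x y
  proof -
    obtain p where p: "p \<in> carrier (F2g g)" "exponents g p = x" by (rule exponents_surj[OF xy(1)])
    obtain q where q: "q \<in> carrier (F2g g)" "exponents g q = y" by (rule exponents_surj[OF xy(2)])
    have "\<pi> g \<phi> *\<^sub>v x = exponents g (\<phi> p)" "\<pi> g \<phi> *\<^sub>v y = exponents g (\<phi> q)"
      using pi_exponents[OF assms(1)] p q by auto
    then show ?thesis using assms(2) p q by (auto simp: symp_isometry_def)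
  qed
  with pi_in_GL[OF assms(1)] show ?thesis by (simp add: Sp_def)
qed

section \<open>The generators \<open>u_aut\<close> act on exponent vectors as transvections\<close>

definition twist_vec :: "nat \<Rightarrow> nat \<Rightarrow> int vec" where
  "twist_vec g i = (let k = i div 2 in
    if i = 1 then unit_vec (2 * g) 0
    else if i = 2 * g + 1 then unit_vec (2 * g) (g - 1)
    else if even i then unit_vec (2 * g) (g + (k - 1))
    else unit_vec (2 * g) (k - 1) - unit_vec (2 * g) k)"

lemma twist_vec_closed: "twist_vec g i \<in> carrier_vec (2 * g)"
  by (simp add: twist_vec_def Let_def)

text \<open>Writing \<open>Suc k\<close> makes \<open>k\<close> the coordinate index itself, which
  avoids truncated subtraction. The clause \<open>i \<noteq> 1\<close> follows the order of the
  tests in \<open>u_word\<close>.\<close>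

lemma generator_index_cases:
  assumes "i \<in> {1..2 * g + 1}"
  obtains "i = 1" | "i = 2 * g + 1" "i \<noteq> 1" | k where "i = 2 * Suc k" "k < g"
    | k where "i = 2 * Suc k + 1" "Suc k < g"
proof (cases "even i")
  case True
  then obtain k where "i = 2 * k" by (rule evenE)
  then show ?thesis using that(3)[of "k - 1"] assms by auto
next
  case False
  then obtain k where "i = 2 * k + 1" by (rule oddE)
  then show ?thesis using that(1,2) that(4)[of "k - 1"] assms by (cases "k = 0 \<or> k = g") auto
qed

lemma gens_iff [simp]:
  "Gen_a k \<in> gens g \<longleftrightarrow> 1 \<le> k \<and> k \<le> g" "Gen_b k \<in> gens g \<longleftrightarrow> 1 \<le> k \<and> k \<le> g"
  by (auto simp: gens_def)

lemma u_word_in_words: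
  assumes "i \<in> {1..2 * g + 1}" "x \<in> gens g"
  shows "u_word g i x \<in> words (gens g)"
  using assms(1)
proof (cases rule: generator_index_cases)
  case 1
  then show ?thesis using assms(2) by (auto simp: u_word_def)
next
  case 2
  then show ?thesis using assms(2) by (auto simp: u_word_def)
next
  case (3 k)
  then show ?thesis using assms(2) by (auto simp: u_word_def)
next
  case (4 k)
  then show ?thesis using assms(2) by (auto simp: u_word_def)
qed

text \<open>The explicit formulas for the automorphisms are compared with transvections here. A
  generator changes exactly when it pairs nontrivially with the twist vector; the order of letters
  is lost, so left and right multiplication look alike.\<close>

lemma eval_u_word:
  assumes g: "g \<ge> 1" and i: "i \<in> {1..2 * g + 1}" and x: "x \<in> gens g"
  shows "eval_word (Zvec (2 * g)) (gen_vec g) (u_word g i x)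
    = transvection g (twist_vec g i) (gen_vec g x)"
proof -
  interpret Z: group "Zvec (2 * g)" by (rule group_Zvec)
  note simps = u_word_def twist_vec_def transvection_def gen_vec_def symp_form_unit_vec
    monoid_vec_simps inv_Zvec
  \<comment> \<open>Generators are numbered from 1 and coordinates from 0, so \<open>m\<close> is
    the coordinate, offset by \<open>g\<close> for \<open>Gen_b\<close>.\<close>
  obtain m where m: "x = Gen_a (Suc m) \<or> x = Gen_b (Suc m)" "m < g"
    using x by (auto simp: gens_def gr0_conv_Suc Suc_le_eq)
  show ?thesis
    using i
  proof (cases rule: generator_index_cases)
    case 1
    then show ?thesis
      using g m by (intro eq_vecI) (auto simp: simps symp_form_unit_vec(1)[of 0, simplified] split: if_splits)
  next
    case 2
    define h where "h = g - 1"
    have h: "h < g" "g = Suc h" using g by (simp_all add: h_def)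
    have c: "twist_vec g i = unit_vec (2 * g) h" using 2 by (simp add: twist_vec_def h_def)
    have u: "u_word g i x = (if x = Gen_b (Suc h) then [pos (Gen_b (Suc h)), pos (Gen_a (Suc h))] else [pos x])"
      using 2 by (simp add: u_word_def flip: h(2))
    show ?thesis
      unfolding transvection_def c u using m h(1)
      by (intro eq_vecI)
        (auto simp: gen_vec_def symp_form_unit_vec monoid_vec_simps inv_Zvec split: if_splits)
  next
    case (3 k)
    then show ?thesis using m by (intro eq_vecI) (auto simp: simps split: if_splits)
  next
    case (4 k)
    have c: "twist_vec g i = unit_vec (2 * g) k - unit_vec (2 * g) (Suc k)"
      using 4 by (simp add: twist_vec_def)
    \<comment> \<open>The twist vector pairs with \<open>Gen_b (Suc m)\<close> to 1, -1 and 0 in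
      these cases, and with every \<open>Gen_a\<close> to 0.\<close>
    consider "m = k" | "m = Suc k" | "m \<noteq> k" "m \<noteq> Suc k" by blast
    then show ?thesis
    proof cases
      case 1
      with m 4 show ?thesis
        unfolding transvection_def c
        by (intro eq_vecI) (auto simp: u_word_def gen_vec_def symp_form_unit_vec monoid_vec_simps inv_Zvec split: if_splits)
    next
      case 2
      with m 4 show ?thesis
        unfolding transvection_def c
        by (intro eq_vecI) (auto simp: u_word_def gen_vec_def symp_form_unit_vec monoid_vec_simps inv_Zvec split: if_splits)
    next
      case 3
      with m 4 show ?thesis
        unfolding transvection_def c
        by (intro eq_vecI) (auto simp: u_word_def gen_vec_def symp_form_unit_vec monoid_vec_simps inv_Zvec split: if_splits)
    qed
  qed
qed

text \<open>Both sides are homomorphisms from the free group to the integer vectors, so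
  \<open>eval_u_word\<close> on the generators is enough.\<close>

lemma exponents_u_aut:
  assumes g: "g \<ge> 1" and i: "i \<in> {1..2 * g + 1}" and p: "p \<in> carrier (F2g g)"
  shows "exponents g (u_aut g i p) = transvection g (twist_vec g i) (exponents g p)"
proof -
  let ?h = "\<lambda>x. F2g_class g (u_word g i x)"
  have img: "?h ` gens g \<subseteq> carrier (F2g g)"
    using u_word_in_words[OF i] by (auto intro: F2g_class_closed)
  have "u_aut g i \<in> hom (F2g g) (F2g g)"
    using group.free_extension_hom[OF group_F2g img] by (simp add: u_aut_def F2g_def)
  then have "(exponents g \<circ> u_aut g i) p = (transvection g (twist_vec g i) \<circ> exponents g) p"
  proof (intro F2g_hom_eqI[OF hom_compose[OF _ exponents_hom]
        hom_compose[OF exponents_hom transvection_hom[OF twist_vec_closed]] group_Zvec _ p])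
    fix x assume x: "x \<in> gens g"
    have "u_aut g i (F2g_class g [pos x]) = eval_word (F2g g) ?h [pos x]"
      using group.free_extension_word_class[OF group_F2g img, of "[pos x]"] x
      by (simp add: u_aut_def F2g_class_def)
    also have "\<dots> = ?h x"
    proof -
      interpret F: group "F2g g" by (rule group_F2g)
      have "?h x \<in> carrier (F2g g)" using img x by blast
      then show ?thesis by simp
    qed
    finally show "(exponents g \<circ> u_aut g i) (F2g_class g [pos x])
        = (transvection g (twist_vec g i) \<circ> exponents g) (F2g_class g [pos x])"
      by (simp add: exponents_class u_word_in_words[OF i x] eval_u_word[OF g i x] exponents_gen x
          del: words_simps)
  qed
  then show ?thesis by simp
qed

lemma symp_isometry_u_aut:
  assumes "g \<ge> 1" "i \<in> {1..2 * g + 1}"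
  shows "symp_isometry g (u_aut g i)"
  unfolding symp_isometry_def
  by (simp add: exponents_u_aut[OF assms] transvection_symp_form twist_vec_closed exponents_closed)

section \<open>From the generators to the whole braid group\<close>

lemma AutoGroup_simps:
  "carrier (AutoGroup G) = auto G"
  "\<one>\<^bsub>AutoGroup G\<^esub> = (\<lambda>x\<in>carrier G. x)"
  "\<phi> \<in> auto G \<Longrightarrow> \<psi> \<in> auto G \<Longrightarrow> p \<in> carrier G \<Longrightarrow> (\<phi> \<otimes>\<^bsub>AutoGroup G\<^esub> \<psi>) p = \<phi> (\<psi> p)"
  by (auto simp: AutoGroup_def BijGroup_def auto_def compose_def)

text \<open>Induction on the generated subgroup, since \<phi> ranges over images under
  \<open>f\<close>: identity, products and inverses of isometries are isometries.\<close>

lemma symp_isometry_hom_image: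
  assumes G: "group G" and f: "f \<in> hom G (AutoGroup (F2g g))"
    and gens: "X \<subseteq> carrier G" "\<And>x. x \<in> X \<Longrightarrow> symp_isometry g (f x)"
    and y: "y \<in> generate G X"
  shows "symp_isometry g (f y)"
proof -
  interpret f: group_hom G "AutoGroup (F2g g)" f
    by (intro group_hom.intro group_hom_axioms.intro G f group.AutoGroup group_F2g)
  have auto_f: "f x \<in> auto (F2g g)" if "x \<in> carrier G" for x
    using hom_in_carrier[OF f that] by (simp add: AutoGroup_simps)
  have closed: "f x p \<in> carrier (F2g g)" if "x \<in> carrier G" "p \<in> carrier (F2g g)" for x p
    using auto_f[OF that(1)] hom_in_carrier[OF _ that(2)] by (auto simp: auto_def)
  have mult: "f (a \<otimes>\<^bsub>G\<^esub> b) p = f a (f b p)"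
    if "a \<in> carrier G" "b \<in> carrier G" "p \<in> carrier (F2g g)" for a b p
    using that by (simp add: auto_f AutoGroup_simps)
  have f_one: "f \<one>\<^bsub>G\<^esub> p = p" if "p \<in> carrier (F2g g)" for p
    using that by (simp add: AutoGroup_simps)
  show ?thesis
    using y
  proof induction
    case one
    \<comment> \<open>\<open>f.hom_one\<close> is switched off because it would rewrite the left
      side of \<open>f_one\<close> before that equation can apply.\<close>
    show ?case unfolding symp_isometry_def by (simp add: f_one del: f.hom_one)
  next
    case (incl a)
    then show ?case by (rule gens(2))
  next
    case (inv a)
    then have a: "a \<in> carrier G" "inv\<^bsub>G\<^esub> a \<in> carrier G" using gens(1) by auto
    \<comment> \<open>The isometry property of \<open>f a\<close>, used at the images of
      \<open>p\<close> and \<open>q\<close> under the inverse, then reads as the property of the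
      inverse.\<close>
    have "f a (f (inv\<^bsub>G\<^esub> a) p) = p" if "p \<in> carrier (F2g g)" for p
      using mult[OF a that] a f_one[OF that] by simp
    then show ?case
      using gens(2)[OF inv] closed[OF a(2)] unfolding symp_isometry_def by metis
  next
    case (eng a b)
    then have ab: "a \<in> carrier G" "b \<in> carrier G"
      by (simp_all add: f.G.generate_in_carrier[OF gens(1)])
    then show ?case
      using eng.IH closed[OF ab(2)] mult[OF ab] unfolding symp_isometry_def by metis
  qed
qed

theorem proposition4p1:
  fixes g :: nat
    and f :: "nat word set \<Rightarrow> (gen word set \<Rightarrow> gen word set)"
  assumes "g \<ge> 1"
    and "f \<in> hom (braid_group (2 * g + 2)) (AutoGroup (F2g g))"
    and "\<And>i. i \<in> {1..2 * g + 1} \<Longrightarrow> f (\<sigma> (2 * g + 2) i) = u_aut g i"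
  shows "(\<pi> g \<circ> f) ` carrier (braid_group (2 * g + 2)) \<subseteq> carrier (Sp g)"
proof -
  let ?B = "braid_group (2 * g + 2)"
  let ?X = "\<sigma> (2 * g + 2) ` {1..2 * g + 1}"
  have B: "group ?B" unfolding braid_group_def by (rule group_presented_group)
  \<comment> \<open>For \<open>2 * g + 2\<close> strands the index set \<open>{1..n - 1}\<close> of
    the braid generators is \<open>{1..2 * g + 1}\<close>.\<close>
  have gen: "carrier ?B = generate ?B ?X"
    using presented_group_generate[of "{1..2 * g + 1}" "braid_relations (2 * g + 2)"]
    by (simp add: braid_group_def \<sigma>_def[abs_def])
  have "\<pi> g (f y) \<in> carrier (Sp g)" if y: "y \<in> carrier ?B" for y
  proof (rule pi_in_Sp)
    \<comment> \<open>Bijectivity comes from the codomain of \<open>f\<close>, so no inverse of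
      \<open>u_aut\<close> has to be written down.\<close>
    show "f y \<in> auto (F2g g)"
      using hom_in_carrier[OF assms(2) y] by (simp add: AutoGroup_simps)
    show "symp_isometry g (f y)"
    proof (rule symp_isometry_hom_image[OF B assms(2)])
      show "?X \<subseteq> carrier ?B" using generate.incl[of _ ?X ?B] unfolding gen by blast
      show "y \<in> generate ?B ?X" using y gen by simp
      fix x assume "x \<in> ?X"
      then obtain i where "x = \<sigma> (2 * g + 2) i" "i \<in> {1..2 * g + 1}" by (rule imageE)
      then show "symp_isometry g (f x)"
        by (simp only: assms(3) symp_isometry_u_aut[OF assms(1)])
    qed
  qed
  then show ?thesis by auto
qed

end
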